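(* Let $G=\gamma_1\times\gamma_2\times\cdots\times\gamma_k$ be a torus (each $\gamma_i$ an undirected cycle) that has a Hamiltonian cycle, suppose $|G|$ is even, and let $\gamma_{k+1}$ be an undirected cycle. Then $\mathrm{mrl}(G\times\gamma_{k+1})\geq \mathrm{mrl}(G)$.
   Context: A torus is a Cartesian product $G=\gamma_1\times\gamma_2\times\cdots\times\gamma_k$ where each $\gamma_i$ is a cycle; it comes with this decomposition, the $\gamma_i$ are called the dimensions of $G$, and every edge of $G$ lies in exactly one dimension (the index $i$ of the coordinate that changes along the edge). A cycle has at least two vertices; a cycle on two vertices is allowed (as a closed walk it traverses back and forth between its two vertices). $|G|=\prod_i|\gamma_i|$ is the number of vertices of $G$. $G\times\gamma_{k+1}$ is regarded as the torus with dimensions $\gamma_1,\dots,\gamma_{k+1}$. A Hamiltonian cycle in $G$ is a cycle passing through every vertex exactly once. The run length $\mathrm{rl}(H)$ of a Hamiltonian cycle $H$ in $G$ is the maximum $r$ such that any sequence of $r$ (cyclically) consecutive edges of $H$ contains no more than one edge in any one dimension. The maximum run length $\mathrm{mrl}(G)$ is the maximum of $\mathrm{rl}(H)$ over all Hamiltonian cycles $H$ in $G$. *)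

theory Defs
  imports Main
begin

text \<open>
  Up to isomorphism, a torus is given by the list \<open>ns\<close> of the lengths of its cycles; the dimensions
  are the indices \<open>i < length ns\<close>. Its vertices are the lists \<open>u\<close> with \<open>u ! i < ns ! i\<close> for each \<open>i\<close>,
  and the product with one further cycle of length \<open>m\<close> is \<open>ns @ [m]\<close>.
\<close>

definition is_torus :: "nat list \<Rightarrow> bool" where
  "is_torus ns \<longleftrightarrow> ns \<noteq> [] \<and> (\<forall>n \<in> set ns. 2 \<le> n)"

definition verts :: "nat list \<Rightarrow> nat list set" where
  "verts ns = {u. length u = length ns \<and> (\<forall>i < length ns. u ! i < ns ! i)}"

definition cycle_adj :: "nat \<Rightarrow> nat \<Rightarrow> nat \<Rightarrow> bool" where
  "cycle_adj n a b \<longleftrightarrow> a < n \<and> b < n \<and> (b = Suc a mod n \<or> a = Suc b mod n)"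

definition edge_in_dim :: "nat list \<Rightarrow> nat \<Rightarrow> nat list \<Rightarrow> nat list \<Rightarrow> bool" where
  "edge_in_dim ns i u v \<longleftrightarrow>
     u \<in> verts ns \<and> v \<in> verts ns \<and> i < length ns \<and>
     cycle_adj (ns ! i) (u ! i) (v ! i) \<and>
     (\<forall>j < length ns. j \<noteq> i \<longrightarrow> u ! j = v ! j)"

definition torus_adj :: "nat list \<Rightarrow> nat list \<Rightarrow> nat list \<Rightarrow> bool" where
  "torus_adj ns u v \<longleftrightarrow> (\<exists>i < length ns. edge_in_dim ns i u v)"

text \<open>
  A Hamiltonian cycle is given by the list \<open>H\<close> of its vertices in cyclic order. Its edges are indexed
  by positions: the \<open>j\<close>-th edge joins the \<open>j\<close>-th vertex to the next one, with indices taken modulo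
  \<open>length H\<close>. If the torus has only two vertices, \<open>H\<close> is the closed walk going back and forth, whose
  two steps count as two edges.
\<close>

definition hamiltonian_cycle :: "nat list \<Rightarrow> nat list list \<Rightarrow> bool" where
  "hamiltonian_cycle ns H \<longleftrightarrow>
     distinct H \<and> set H = verts ns \<and>
     (\<forall>j < length H. torus_adj ns (H ! j) (H ! (Suc j mod length H)))"

definition step_in_dim :: "nat list \<Rightarrow> nat list list \<Rightarrow> nat \<Rightarrow> nat \<Rightarrow> bool" where
  "step_in_dim ns H i j \<longleftrightarrow>
     edge_in_dim ns i (H ! (j mod length H)) (H ! (Suc j mod length H))"

text \<open>
  For a Hamiltonian cycle of a torus with \<open>k\<close> dimensions, the set below contains \<open>1\<close> and, by the
  pigeonhole principle, no \<open>r > k\<close>, so the maximum exists.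
\<close>

definition run_length :: "nat list \<Rightarrow> nat list list \<Rightarrow> nat" where
  "run_length ns H =
     Max {r. \<forall>s. \<forall>i < length ns. card {j \<in> {s..<s + r}. step_in_dim ns H i j} \<le> 1}"

text \<open>Meaningful only if the torus has a Hamiltonian cycle.\<close>

definition max_run_length :: "nat list \<Rightarrow> nat" where
  "max_run_length ns = Max {run_length ns H | H. hamiltonian_cycle ns H}"

end

theory Submission
  imports Defs
begin

text \<open>
  Let \<open>h 0, h 1, \<dots>\<close> be a Hamiltonian cycle of \<open>G\<close> of length \<open>N\<close> with the required run length.
  Put a copy of it into every layer of \<open>G \<times> \<gamma>\<close> and join the copies in the layers \<open>y\<close> and \<open>y + 1\<close> by
  exchanging one edge \<open>{h (c - 1), h c}\<close> of each copy for two edges of \<open>\<gamma>\<close>. For these to exist, the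
  copy in layer \<open>y + 1\<close> is taken to be the image of the one in layer \<open>y\<close> under a point reflection
  \<open>w \<mapsto> u + v - w\<close> that swaps the two end points of the edge; it preserves dimensions.
  The index into \<open>h\<close> still advances by one in each step, so that the new cycle uses the same
  dimensions as \<open>h\<close> at the same times, except where \<open>\<gamma>\<close> is used. With \<open>c\<close> alternating between
  \<open>N div 2\<close> and \<open>N\<close>, the steps along \<open>\<gamma>\<close> are at least \<open>N div 2\<close> apart, and \<open>N div 2\<close> is at least the
  number of dimensions, hence at least the run length. The layers are visited as in plain
  hunting of bells: \<open>0, 1, \<dots>, m - 1, m - 1, \<dots>, 1, 0\<close>, for half a turn of \<open>h\<close> each.
\<close>

section \<open>Vertices and edges\<close>

lemma verts_append_iff:
  "w \<in> verts (ns @ [m]) \<longleftrightarrow> (\<exists>u y. w = u @ [y] \<and> u \<in> verts ns \<and> y < m)"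
proof
  assume w: "w \<in> verts (ns @ [m])"
  then obtain u y where uy: "w = u @ [y]" "length u = length ns"
    unfolding verts_def by (cases w rule: rev_cases) auto
  have "u ! i < ns ! i" if "i < length ns" for i
    using w that uy unfolding verts_def by (auto simp: nth_append dest: spec[of _ i])
  moreover have "y < m"
    using w uy unfolding verts_def by (auto simp: nth_append dest: spec[of _ "length ns"])
  ultimately show "\<exists>u y. w = u @ [y] \<and> u \<in> verts ns \<and> y < m"
    using uy unfolding verts_def by auto
qed (auto simp: verts_def nth_append less_Suc_eq)

lemma append_in_verts_iff: "u @ [y] \<in> verts (ns @ [m]) \<longleftrightarrow> u \<in> verts ns \<and> y < m"
  by (auto simp: verts_append_iff)

lemma finite_verts: "finite (verts ns)"
proof (rule finite_subset)
  show "verts ns \<subseteq> {u. set u \<subseteq> {..sum_list ns} \<and> length u = length ns}"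
  proof (clarsimp simp: verts_def)
    fix u x assume "length u = length ns" "\<forall>i<length ns. u ! i < ns ! i" "x \<in> set u"
    then obtain i where "i < length ns" "x < ns ! i" by (metis in_set_conv_nth)
    then show "x \<le> sum_list ns"
      using elem_le_sum_list[of i ns] by linarith
  qed
qed (rule finite_lists_length_eq, simp)

lemma card_verts_append: "card (verts (ns @ [m])) = card (verts ns) * m"
proof -
  have "verts (ns @ [m]) = (\<lambda>(u, y). u @ [y]) ` (verts ns \<times> {..<m})"
    by (auto simp: verts_append_iff)
  moreover have "inj_on (\<lambda>(u, y). u @ [y]) (verts ns \<times> {..<m})"
    by (auto simp: inj_on_def)
  ultimately show ?thesis by (simp add: card_image card_cartesian_product)
qed

text \<open>All 0/1 vectors are vertices, since every cycle has at least two. The bound later makes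
  half a turn of the cycle at least as long as the number of dimensions.\<close>

lemma two_power_le_card_verts:
  assumes "is_torus ns" shows "2 ^ length ns \<le> card (verts ns)"
proof -
  have "{u. set u \<subseteq> {0, 1} \<and> length u = length ns} \<subseteq> verts ns"
  proof (clarsimp simp: verts_def)
    fix u i assume "set u \<subseteq> {0, Suc 0}" "length u = length ns" "i < length ns"
    then have "u ! i \<in> {0, Suc 0}" "ns ! i \<in> set ns"
      by (metis nth_mem subsetD)+
    then have "u ! i \<le> 1" "2 \<le> ns ! i" using assms by (auto simp: is_torus_def)
    then show "u ! i < ns ! i" by linarith
  qed
  from card_mono[OF finite_verts this] show ?thesis
    by (simp add: card_lists_length_eq numeral_2_eq_2)
qed

lemma cycle_adj_neq: "2 \<le> n \<Longrightarrow> cycle_adj n a b \<Longrightarrow> a \<noteq> b"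
  unfolding cycle_adj_def by (auto simp: mod_Suc split: if_splits)

lemma edge_in_dim_append:
  assumes "length u = length ns" "length v = length ns" "i < length ns"
  shows "edge_in_dim (ns @ [m]) i (u @ [y]) (v @ [z]) \<longleftrightarrow> edge_in_dim ns i u v \<and> y = z \<and> y < m"
  using assms unfolding edge_in_dim_def append_in_verts_iff
  by (auto simp: nth_append less_Suc_eq)

lemma edge_in_last_dim:
  assumes "length u = length ns" "length v = length ns"
  shows "edge_in_dim (ns @ [m]) (length ns) (u @ [y]) (v @ [z]) \<longleftrightarrow>
    u \<in> verts ns \<and> u = v \<and> cycle_adj m y z"
  using assms unfolding edge_in_dim_def append_in_verts_iff
  by (auto simp: nth_append less_Suc_eq cycle_adj_def intro: nth_equalityI)

lemma edge_in_dim_irrefl: "is_torus ns \<Longrightarrow> \<not> edge_in_dim ns i u u"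
  unfolding edge_in_dim_def is_torus_def using cycle_adj_neq nth_mem[of i ns] by blast

section \<open>Point reflections\<close>

text \<open>This is \<open>s - x\<close> modulo \<open>n\<close>; adding \<open>n\<close> first
  keeps the natural subtraction from truncating when \<open>x < n\<close>.\<close>

definition reflect :: "nat \<Rightarrow> nat \<Rightarrow> nat \<Rightarrow> nat" where
  "reflect n s x = (s + n - x) mod n"

lemma reflect_less: "x < n \<Longrightarrow> reflect n s x < n"
  unfolding reflect_def by simp

lemma reflect_reflect:
  assumes "x < n" shows "reflect n s (reflect n s x) = x"
proof -
  define q where "q = (s + n - x) mod n"
  have "s + n - x = n * ((s + n - x) div n) + q" unfolding q_def by simp
  moreover have "q < n" using assms by (simp add: q_def)
  ultimately have "s + n - q = x + n * ((s + n - x) div n)" using assms by linarith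
  then have "(s + n - q) mod n = x" using assms by simp
  then show ?thesis by (simp add: reflect_def q_def)
qed

lemma reflect_add:
  assumes "x < n" "y < n"
  shows "reflect n (x + y) x = y" "reflect n (x + y) y = x"
proof -
  have "x + y + n - x = y + n" "x + y + n - y = x + n" by simp_all
  then show "reflect n (x + y) x = y" "reflect n (x + y) y = x"
    using assms by (simp_all add: reflect_def)
qed

text \<open>A reflection reverses the orientation of the cycle. Adjacency survives because it is
  symmetric.\<close>

lemma reflect_Suc_mod:
  assumes "x < n" shows "reflect n s x = Suc (reflect n s (Suc x mod n)) mod n"
proof (cases "Suc x = n")
  case True
  then have "s + n - x = Suc s" by auto
  then show ?thesis by (simp add: reflect_def True mod_Suc_eq)
next
  case False
  then have "Suc x < n" using assms by simp
  moreover from this have "s + n - x = Suc (s + n - Suc x)" by linarith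
  ultimately show ?thesis by (simp add: reflect_def mod_Suc_eq)
qed

lemma cycle_adj_reflect: "cycle_adj n x y \<Longrightarrow> cycle_adj n (reflect n s x) (reflect n s y)"
  unfolding cycle_adj_def using reflect_Suc_mod reflect_less by metis

lemma cycle_adj_reflect_iff:
  "x < n \<Longrightarrow> y < n \<Longrightarrow> cycle_adj n (reflect n s x) (reflect n s y) \<longleftrightarrow> cycle_adj n x y"
  using cycle_adj_reflect reflect_reflect by metis

definition point_reflection :: "nat list \<Rightarrow> nat list \<Rightarrow> nat list \<Rightarrow> nat list \<Rightarrow> nat list" where
  "point_reflection ns u v w = map (\<lambda>i. reflect (ns ! i) (u ! i + v ! i) (w ! i)) [0..<length ns]"

text \<open>Both directions of the equivalence are used: forwards to obtain the edges of the new
  cycle, backwards to read off their dimensions.\<close>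

definition dim_automorphism :: "nat list \<Rightarrow> (nat list \<Rightarrow> nat list) \<Rightarrow> bool" where
  "dim_automorphism ns g \<longleftrightarrow> bij_betw g (verts ns) (verts ns) \<and>
     (\<forall>i. \<forall>u \<in> verts ns. \<forall>v \<in> verts ns. edge_in_dim ns i (g u) (g v) \<longleftrightarrow> edge_in_dim ns i u v)"

lemma point_reflection_in_verts: "w \<in> verts ns \<Longrightarrow> point_reflection ns u v w \<in> verts ns"
  unfolding verts_def point_reflection_def by (simp add: reflect_less)

lemma point_reflection_involution:
  "w \<in> verts ns \<Longrightarrow> point_reflection ns u v (point_reflection ns u v w) = w"
  unfolding verts_def point_reflection_def
  by (auto simp: reflect_reflect intro: nth_equalityI)

lemma point_reflection_swap:
  assumes "u \<in> verts ns" "v \<in> verts ns"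
  shows "point_reflection ns u v u = v" "point_reflection ns u v v = u"
  using assms unfolding verts_def point_reflection_def
  by (auto simp: reflect_add intro!: nth_equalityI)

lemma dim_automorphism_point_reflection: "dim_automorphism ns (point_reflection ns u v)"
  unfolding dim_automorphism_def
proof (intro conjI allI ballI)
  show "bij_betw (point_reflection ns u v) (verts ns) (verts ns)"
    by (rule bij_betw_byWitness[where f' = "point_reflection ns u v"])
      (auto simp: point_reflection_in_verts point_reflection_involution)
next
  fix i x y assume xy: "x \<in> verts ns" "y \<in> verts ns"
  have eq: "reflect (ns ! j) s (x ! j) = reflect (ns ! j) s (y ! j) \<longleftrightarrow> x ! j = y ! j"
    if "j < length ns" for j s
  proof -
    have "x ! j < ns ! j" "y ! j < ns ! j" using xy that by (auto simp: verts_def)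
    then show ?thesis by (metis reflect_reflect)
  qed
  show "edge_in_dim ns i (point_reflection ns u v x) (point_reflection ns u v y) \<longleftrightarrow>
    edge_in_dim ns i x y"
  proof (cases "i < length ns")
    case True
    then have "x ! i < ns ! i" "y ! i < ns ! i" using xy by (auto simp: verts_def)
    then show ?thesis
      using xy True point_reflection_in_verts[of _ ns u v] unfolding edge_in_dim_def
      by (simp add: point_reflection_def eq cycle_adj_reflect_iff cong: conj_cong)
  qed (simp add: edge_in_dim_def)
qed

lemma dim_automorphism_id: "dim_automorphism ns id"
  by (simp add: dim_automorphism_def)

lemma dim_automorphism_comp:
  assumes "dim_automorphism ns f" "dim_automorphism ns g"
  shows "dim_automorphism ns (f \<circ> g)"
  using assms unfolding dim_automorphism_def
  by (auto intro: bij_betw_trans dest: bij_betwE)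

section \<open>Run lengths\<close>

definition run_bound :: "nat list \<Rightarrow> nat list list \<Rightarrow> nat \<Rightarrow> bool" where
  "run_bound ns H r \<longleftrightarrow>
     (\<forall>s. \<forall>i < length ns. card {j \<in> {s..<s + r}. step_in_dim ns H i j} \<le> 1)"

lemma run_length_eq_Max: "run_length ns H = Max {r. run_bound ns H r}"
  unfolding run_length_def run_bound_def ..

lemma length_hamiltonian_cycle: "hamiltonian_cycle ns H \<Longrightarrow> length H = card (verts ns)"
  unfolding hamiltonian_cycle_def using distinct_card by metis

text \<open>Pigeonhole: each of the steps \<open>0, ..., r - 1\<close> lies in some dimension, and
  no dimension receives two of them. This makes the maxima well defined and later compares
  \<open>r\<close> with half a turn.\<close>

lemma run_bound_le:
  assumes "is_torus ns" "hamiltonian_cycle ns H" "run_bound ns H r"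
  shows "r \<le> length ns"
proof -
  have "0 < (2::nat) ^ length ns" by simp
  also have "\<dots> \<le> length H"
    using two_power_le_card_verts[OF assms(1)] length_hamiltonian_cycle[OF assms(2)] by simp
  finally have pos: "0 < length H" .
  have step: "\<exists>i<length ns. step_in_dim ns H i j" for j
  proof -
    have "j mod length H < length H" using pos by simp
    then have "torus_adj ns (H ! (j mod length H)) (H ! (Suc (j mod length H) mod length H))"
      using assms(2) unfolding hamiltonian_cycle_def by simp
    then show ?thesis by (simp add: torus_adj_def step_in_dim_def mod_Suc_eq)
  qed
  have "{0..<r} \<subseteq> (\<Union>i<length ns. {j \<in> {0..<0 + r}. step_in_dim ns H i j})"
  proof
    fix j assume "j \<in> {0..<r}"
    moreover obtain i where "i < length ns" "step_in_dim ns H i j" using step by blast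
    ultimately show "j \<in> (\<Union>i<length ns. {j \<in> {0..<0 + r}. step_in_dim ns H i j})" by auto
  qed
  then have "card {0..<r} \<le> card (\<Union>i<length ns. {j \<in> {0..<0 + r}. step_in_dim ns H i j})"
    by (intro card_mono) auto
  also have "\<dots> \<le> (\<Sum>i<length ns. card {j \<in> {0..<0 + r}. step_in_dim ns H i j})"
    by (intro card_UN_le) simp
  also have "\<dots> \<le> (\<Sum>i<length ns. 1)"
    by (rule sum_mono) (use assms(3)[unfolded run_bound_def, rule_format, of _ 0] in simp)
  finally show ?thesis by simp
qed

lemma finite_run_bounds:
  assumes "is_torus ns" "hamiltonian_cycle ns H"
  shows "finite {r. run_bound ns H r}"
proof (rule finite_subset)
  show "{r. run_bound ns H r} \<subseteq> {..length ns}"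
    using run_bound_le[OF assms] by blast
qed simp

lemma run_bound_run_length:
  assumes "is_torus ns" "hamiltonian_cycle ns H"
  shows "run_bound ns H (run_length ns H)"
proof -
  have "run_bound ns H 0" by (simp add: run_bound_def)
  then show ?thesis
    using Max_in[OF finite_run_bounds[OF assms]] unfolding run_length_eq_Max by blast
qed

lemma le_run_length:
  assumes "is_torus ns" "hamiltonian_cycle ns H" "run_bound ns H r"
  shows "r \<le> run_length ns H"
  using Max_ge[OF finite_run_bounds[OF assms(1,2)]] assms(3)
  by (simp add: run_length_eq_Max)

lemma finite_run_lengths: "finite {run_length ns H | H. hamiltonian_cycle ns H}"
proof -
  have "{H. hamiltonian_cycle ns H} \<subseteq> {H. set H \<subseteq> verts ns \<and> length H = card (verts ns)}"
    by (simp add: subset_iff length_hamiltonian_cycle) (simp add: hamiltonian_cycle_def)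
  then have "finite {H. hamiltonian_cycle ns H}"
    using finite_lists_length_eq[OF finite_verts] finite_subset by blast
  then show ?thesis by simp
qed

section \<open>The cycle in the product\<close>

text \<open>The layer of half turn \<open>s\<close>. Layer \<open>y\<close> occurs at
  \<open>y\<close> and at \<open>2 * m - 1 - y\<close>, which have opposite parity, so it receives
  each half of its copy exactly once.\<close>

definition hunt :: "nat \<Rightarrow> nat \<Rightarrow> nat" where
  "hunt m s = (if s < m then s else 2 * m - 1 - s)"

lemma hunt_less: "s < 2 * m \<Longrightarrow> hunt m s < m"
  unfolding hunt_def by auto

text \<open>The parity clauses ensure that the passages up and down between \<open>y\<close> and
  \<open>Suc y\<close> use the same edge of \<open>h\<close>. Upwards \<open>s = y\<close>;
  downwards \<open>s + y\<close> is even.\<close>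

lemma hunt_Suc_cases:
  assumes "Suc s < 2 * m"
  obtains (stay) "hunt m (Suc s) = hunt m s"
  | (up) y where "Suc y < m" "even y \<longleftrightarrow> even s" "hunt m s = y" "hunt m (Suc s) = Suc y"
  | (down) y where "Suc y < m" "even y \<longleftrightarrow> even s" "hunt m s = Suc y" "hunt m (Suc s) = y"
proof -
  consider "Suc s < m" | "Suc s = m" | "m \<le> s" by linarith
  then show thesis
  proof cases
    case 1
    then show ?thesis using up[of s] by (simp add: hunt_def)
  next
    case 2
    then show ?thesis using stay by (auto simp: hunt_def)
  next
    case 3
    define y where "y = 2 * m - 2 - s"
    have *: "s + y = 2 * (m - 1)" using assms by (simp add: y_def)
    then have "even (s + y)" by simp
    then have "even y \<longleftrightarrow> even s" by simp
    moreover have "hunt m s = Suc y" "hunt m (Suc s) = y" "Suc y < m"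
      using 3 assms by (auto simp: hunt_def y_def)
    ultimately show ?thesis using down by blast
  qed
qed

locale ham_torus =
  fixes ns :: "nat list" and H :: "nat list list" and m :: nat
  assumes torus: "is_torus ns" and ham: "hamiltonian_cycle ns H" and m_ge: "2 \<le> m"
begin

definition N :: nat where "N = length H"

definition h :: "nat \<Rightarrow> nat list" where "h j = H ! (j mod N)"

text \<open>The index \<open>c\<close> of the edge exchanged between the layers \<open>y\<close> and
  \<open>Suc y\<close>. Taking \<open>N\<close> instead of 0 makes \<open>joint y - 1\<close> a true
  predecessor.\<close>

definition joint :: "nat \<Rightarrow> nat" where "joint y = (if even y then N div 2 else N)"

text \<open>The reflection acts before \<open>copy y\<close>, so its centre is given by vertices of
  \<open>h\<close> itself rather than by their images.\<close>

primrec copy :: "nat \<Rightarrow> nat list \<Rightarrow> nat list" where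
  "copy 0 = id"
| "copy (Suc y) = copy y \<circ> point_reflection ns (h (joint y - 1)) (h (joint y))"

definition half_turns :: "nat \<Rightarrow> nat" where
  "half_turns t = 2 * (t div N) + (if t mod N < N div 2 then 0 else 1)"

definition layer :: "nat \<Rightarrow> nat" where "layer t = hunt m (half_turns t)"

definition vertex :: "nat \<Rightarrow> nat list" where
  "vertex t = copy (layer t) (h t) @ [layer t]"

definition lifted :: "nat list list" where
  "lifted = map vertex [0..<N * m]"

section \<open>The base cycle, its copies and its half turns\<close>

lemma N_ge: "2 ^ length ns \<le> N"
  using two_power_le_card_verts[OF torus] length_hamiltonian_cycle[OF ham] by (simp add: N_def)

text \<open>For \<open>k + 1\<close> dimensions, half of the vertex count is at least
  \<open>2 ^ k\<close>, and this exceeds \<open>k\<close>.\<close>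

lemma length_ns_le: "length ns \<le> N div 2"
proof -
  obtain k where k: "length ns = Suc k"
    using torus by (cases ns) (auto simp: is_torus_def)
  have "Suc k \<le> 2 ^ k" using less_exp[of k] by linarith
  then show ?thesis using N_ge by (simp add: k)
qed

lemma half_pos: "0 < N div 2"
proof -
  have "0 < length ns" using torus by (simp add: is_torus_def)
  then show ?thesis using length_ns_le by linarith
qed

lemma N_pos: "0 < N"
  using half_pos by linarith

lemma h_in_verts: "h j \<in> verts ns"
  using ham N_pos unfolding h_def N_def hamiltonian_cycle_def by (metis mod_less_divisor nth_mem)

lemma h_mod: "h (j mod N) = h j"
  by (simp add: h_def)

lemma h_surj: "u \<in> verts ns \<Longrightarrow> \<exists>j<N. u = h j"
  using ham unfolding h_def N_def hamiltonian_cycle_def by (metis in_set_conv_nth mod_less)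

lemma step_in_dim_h: "step_in_dim ns H i j \<longleftrightarrow> edge_in_dim ns i (h j) (h (Suc j))"
  by (simp add: step_in_dim_def h_def N_def)

lemma h_adj: "\<exists>i<length ns. edge_in_dim ns i (h j) (h (Suc j))"
proof -
  have "torus_adj ns (h (j mod N)) (h (Suc (j mod N)))"
    using ham N_pos unfolding hamiltonian_cycle_def h_def N_def by simp
  then show ?thesis
    unfolding torus_adj_def by (simp add: h_def mod_Suc_eq)
qed

lemma copy_automorphism: "dim_automorphism ns (copy y)"
  by (induction y)
    (simp_all only: copy.simps dim_automorphism_id dim_automorphism_comp
      dim_automorphism_point_reflection)

lemma copy_in_verts: "u \<in> verts ns \<Longrightarrow> copy y u \<in> verts ns"
  using copy_automorphism[of y] by (auto simp: dim_automorphism_def dest: bij_betwE)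

lemma edge_in_dim_copy:
  "u \<in> verts ns \<Longrightarrow> v \<in> verts ns \<Longrightarrow>
    edge_in_dim ns i (copy y u) (copy y v) \<longleftrightarrow> edge_in_dim ns i u v"
  using copy_automorphism[of y] by (simp add: dim_automorphism_def)

text \<open>The reflection swaps the ends of the joint edge. Hence changing layer while advancing
  the index of \<open>h\<close> moves only the last coordinate; the first equation serves the way
  up, the second the way down.\<close>

lemma copy_Suc_joint:
  assumes "Suc t mod N = joint y mod N"
  shows "copy (Suc y) (h (Suc t)) = copy y (h t)" "copy (Suc y) (h t) = copy y (h (Suc t))"
proof -
  have pos: "0 < joint y" using half_pos N_pos by (simp add: joint_def)
  have "h (Suc t) = h (joint y)" using assms by (metis h_mod)
  moreover have "h t = h (joint y - 1)"
  proof -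
    have "Suc t mod N = Suc (joint y - 1) mod N" using assms pos by simp
    then have "t mod N = (joint y - 1) mod N"
      by (auto simp: mod_Suc split: if_splits)
    then show ?thesis by (metis h_mod)
  qed
  ultimately show "copy (Suc y) (h (Suc t)) = copy y (h t)" "copy (Suc y) (h t) = copy y (h (Suc t))"
    by (simp_all add: point_reflection_swap h_in_verts)
qed

text \<open>The counter changes when the index of \<open>h\<close> reaches \<open>N div 2\<close> or
  a multiple of \<open>N\<close>, according to its parity. \<open>joint\<close> may be applied to
  the counter because it depends on parity alone.\<close>

lemma half_turns_Suc:
  "half_turns (Suc t) = half_turns t \<or>
   half_turns (Suc t) = Suc (half_turns t) \<and> Suc t mod N = joint (half_turns t) mod N"
proof -
  have "t mod N < N" using N_pos by simp
  then show ?thesis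
    using half_pos by (auto simp: half_turns_def joint_def div_Suc mod_Suc)
qed

lemma half_turns_less: "t < N * m \<Longrightarrow> half_turns t < 2 * m"
proof -
  assume "t < N * m"
  then have "t div N < m" by (simp add: less_mult_imp_div_less mult.commute)
  then show ?thesis by (auto simp: half_turns_def)
qed

lemma layer_less: "t < N * m \<Longrightarrow> layer t < m"
  by (simp add: layer_def half_turns_less hunt_less)

lemma layer_Suc_cases:
  assumes "t < N * m"
  obtains (stay) "layer (Suc t mod (N * m)) = layer t"
  | (up) y where "Suc t mod N = joint y mod N" "Suc y < m" 
      "layer t = y" "layer (Suc t mod (N * m)) = Suc y"
  | (down) y where "Suc t mod N = joint y mod N" "Suc y < m" 
      "layer t = Suc y" "layer (Suc t mod (N * m)) = y"
proof (cases "Suc t = N * m")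
  \<comment> \<open>The closing step: the last half turn \<open>2 * m - 1\<close> and the first one
    both run in layer 0.\<close>
  case True
  have t: "t = (N - 1) + N * (m - 1)"
    using True N_pos m_ge by (cases N; cases m) (auto simp: algebra_simps)
  have "(x + N * k) div N = k" "(x + N * k) mod N = x" if "x < N" for x k
    using that by simp_all
  from this[of "N - 1" "m - 1"] have "t div N = m - 1" "t mod N = N - 1"
    using N_pos by (simp_all only: t diff_less zero_less_one)
  then have "half_turns t = 2 * m - 1"
    using half_pos m_ge by (auto simp: half_turns_def)
  then have "layer t = 0" using m_ge by (simp add: layer_def hunt_def)
  moreover have "layer 0 = 0" using half_pos m_ge by (simp add: layer_def hunt_def half_turns_def)
  ultimately show thesis using stay True by simp
next
  case False
  then have lt: "Suc t < N * m" using assms by simp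
  show thesis
  proof (cases "half_turns (Suc t) = half_turns t")
    case True
    then show ?thesis using stay lt by (simp add: layer_def)
  next
    case False
    then have s: "half_turns (Suc t) = Suc (half_turns t)"
      "Suc t mod N = joint (half_turns t) mod N"
      using half_turns_Suc by blast+
    then have "Suc (half_turns t) < 2 * m" using half_turns_less[OF lt] by simp
    then show ?thesis
    proof (cases rule: hunt_Suc_cases)
      case stay
      then show ?thesis using that(1) lt s by (simp add: layer_def)
    next
      \<comment> \<open>Here \<open>y\<close> and the counter have equal parity, so they have the
        same joint.\<close>
      case (up y)
      then show ?thesis using that(2)[of y] lt s by (simp add: layer_def joint_def)
    next
      case (down y)
      then show ?thesis using that(3)[of y] lt s by (simp add: layer_def joint_def)
    qed
  qed
qed

section \<open>The lifted cycle is Hamiltonian\<close>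

lemma vertex_in_verts: "t < N * m \<Longrightarrow> vertex t \<in> verts (ns @ [m])"
  by (simp add: vertex_def append_in_verts_iff copy_in_verts h_in_verts layer_less)

lemma length_copy: "u \<in> verts ns \<Longrightarrow> length (copy y u) = length ns"
  using copy_in_verts by (simp add: verts_def)

lemma h_Suc_mod: "h (Suc t mod (N * m)) = h (Suc t)"
  by (simp add: h_def mod_mult_right_eq mod_mod_cancel)

text \<open>A horizontal step is the image of the step of \<open>h\<close> at the same time; a
  vertical one replaces that step at a joint.\<close>

lemma vertex_Suc_cases:
  assumes "t < N * m"
  obtains (horizontal) y where "y < m" "vertex t = copy y (h t) @ [y]"
      "vertex (Suc t mod (N * m)) = copy y (h (Suc t)) @ [y]"
  | (vertical) u y z where "u \<in> verts ns" "vertex t = u @ [y]"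
      "vertex (Suc t mod (N * m)) = u @ [z]" "cycle_adj m y z" "Suc t mod N \<in> {0, N div 2}"
proof -
  have joint: "joint y mod N \<in> {0, N div 2}" for y
    using N_pos by (simp add: joint_def)
  from assms show thesis
  proof (cases rule: layer_Suc_cases)
    case stay
    then show ?thesis
      using that(1)[of "layer t"] assms by (simp add: vertex_def h_Suc_mod layer_less)
  next
    case (up y)
    then show ?thesis
      using that(2)[of "copy y (h t)" y "Suc y"] joint[of y] copy_Suc_joint(1)[OF up(1)]
      by (simp add: vertex_def h_Suc_mod copy_in_verts h_in_verts cycle_adj_def
          del: copy.simps)
  next
    case (down y)
    then show ?thesis
      using that(2)[of "copy y (h (Suc t))" "Suc y" y] joint[of y] copy_Suc_joint(2)[OF down(1)]
      by (simp add: vertex_def h_Suc_mod copy_in_verts h_in_verts cycle_adj_def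
          del: copy.simps)
  qed
qed

lemma vertex_adj:
  assumes "t < N * m"
  shows "torus_adj (ns @ [m]) (vertex t) (vertex (Suc t mod (N * m)))"
  using assms
proof (cases rule: vertex_Suc_cases)
  case (horizontal y)
  obtain i where "i < length ns" "edge_in_dim ns i (h t) (h (Suc t))" using h_adj by blast
  with horizontal show ?thesis unfolding torus_adj_def
    by (intro exI[of _ i])
      (simp add: edge_in_dim_append length_copy h_in_verts edge_in_dim_copy)
next
  case (vertical u y z)
  then have "length u = length ns" by (simp add: verts_def)
  with vertical show ?thesis unfolding torus_adj_def
    by (intro exI[of _ "length ns"]) (simp add: edge_in_last_dim)
qed

lemma vertex_surj:
  assumes "w \<in> verts (ns @ [m])" shows "\<exists>t<N * m. w = vertex t"
proof -
  obtain u y where w: "w = u @ [y]" "u \<in> verts ns" "y < m"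
    using assms verts_append_iff by blast
  then obtain v where v: "v \<in> verts ns" "u = copy y v"
    using copy_automorphism[of y] unfolding dim_automorphism_def bij_betw_def by blast
  obtain j where j: "j < N" "v = h j" using h_surj[OF v(1)] by blast
  \<comment> \<open>\<open>b\<close> tells which half of a turn contains \<open>j\<close>, and
    \<open>s\<close> is the one of the two visits to layer \<open>y\<close> with parity
    \<open>b\<close>. The time wanted is index \<open>j\<close> within turn
    \<open>s div 2\<close>.\<close>
  define b :: nat where "b = (if j < N div 2 then 0 else 1)"
  define s where "s = (if even y \<longleftrightarrow> b = 0 then y else 2 * m - 1 - y)"
  have s: "s < 2 * m" "hunt m s = y" using w by (auto simp: s_def hunt_def)
  have "even s \<longleftrightarrow> b = 0"
    using w(3) by (auto simp: s_def b_def even_diff_nat)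
  then have sb: "s = 2 * (s div 2) + b"
    by (cases "even s") (auto simp: b_def elim: oddE split: if_splits)
  define t where "t = j + N * (s div 2)"
  have "t div N = s div 2" "t mod N = j" using j N_pos by (simp_all add: t_def)
  then have "half_turns t = s" "h t = v"
    using sb j h_mod[of t] by (simp_all add: half_turns_def b_def)
  then have "vertex t = w" using s w v by (simp add: vertex_def layer_def)
  moreover have "t < N * m"
  proof -
    have "s div 2 < m" using s by simp
    then have "N * Suc (s div 2) \<le> N * m" by (intro mult_le_mono2) simp
    then show ?thesis using j by (simp add: t_def)
  qed
  ultimately show ?thesis by blast
qed

lemma set_lifted: "set lifted = verts (ns @ [m])"
  using vertex_surj vertex_in_verts by (force simp: lifted_def)

lemma length_lifted: "length lifted = N * m"
  by (simp add: lifted_def)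

lemma lifted_nth: "t < N * m \<Longrightarrow> lifted ! t = vertex t"
  by (simp add: lifted_def)

lemma hamiltonian_lifted: "hamiltonian_cycle (ns @ [m]) lifted"
proof -
  \<comment> \<open>Every vertex is visited and the length equals their number, so none is
    repeated.\<close>
  have "card (set lifted) = length lifted"
    using card_verts_append[of ns m] length_hamiltonian_cycle[OF ham]
    by (simp add: set_lifted length_lifted N_def)
  then have "distinct lifted" by (rule card_distinct)
  moreover have "Suc t mod (N * m) < N * m" for t using N_pos m_ge by simp
  ultimately show ?thesis
    unfolding hamiltonian_cycle_def
    by (simp add: set_lifted length_lifted lifted_nth vertex_adj)
qed

section \<open>Run length of the lifted cycle\<close>

lemma step_in_dim_lifted:
  assumes "step_in_dim (ns @ [m]) lifted i t"
  shows "if i < length ns then step_in_dim ns H i t else Suc t mod N \<in> {0, N div 2}"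
proof -
  define q where "q = t mod (N * m)"
  have pos: "0 < N * m" using N_pos m_ge by simp
  then have q: "q < N * m" by (simp add: q_def)
  \<comment> \<open>Reducing the time modulo \<open>N * m\<close> is harmless to \<open>h\<close>,
    whose period \<open>N\<close> divides it.\<close>
  have qN: "q mod N = t mod N" "Suc q mod N = Suc t mod N"
    by (simp_all add: q_def mod_mod_cancel mod_Suc)
  have hq: "h q = h t" "h (Suc q) = h (Suc t)" using qN by (metis h_mod)+
  have edge: "edge_in_dim (ns @ [m]) i (vertex q) (vertex (Suc q mod (N * m)))"
    using assms pos q by (simp add: step_in_dim_def length_lifted lifted_nth q_def mod_Suc_eq)
  from q show ?thesis
  proof (cases rule: vertex_Suc_cases)
    case (horizontal y)
    have i: "i < length ns"
    proof (rule ccontr)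
      assume "\<not> i < length ns"
      then have "i = length ns" using edge by (simp add: edge_in_dim_def)
      then have "cycle_adj m y y"
        using edge horizontal by (simp add: edge_in_last_dim length_copy h_in_verts)
      then show False using m_ge cycle_adj_neq by blast
    qed
    then show ?thesis
      using edge horizontal
      by (simp add: edge_in_dim_append length_copy h_in_verts edge_in_dim_copy step_in_dim_h hq)
  next
    case (vertical u y z)
    have "\<not> i < length ns"
    proof
      assume "i < length ns"
      then have "edge_in_dim ns i u u"
        using edge vertical by (simp add: edge_in_dim_append verts_def)
      then show False using edge_in_dim_irrefl[OF torus] by blast
    qed
    then show ?thesis using vertical qN by simp
  qed
qed

lemma joints_apart:
  assumes "Suc t mod N \<in> {0, N div 2}" "Suc t' mod N \<in> {0, N div 2}" "t < t'"
  shows "t + N div 2 \<le> t'"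
proof (rule ccontr)
  assume "\<not> t + N div 2 \<le> t'"
  then obtain d where d: "t' = t + d" "0 < d" "d < N div 2"
    using assms(3) by (metis less_add_eq_less less_imp_add_positive linorder_not_le nat_add_left_cancel_less)
  have "Suc t' mod N = (Suc t mod N + d) mod N" by (simp add: d mod_add_left_eq)
  \<comment> \<open>No wrap-around occurs, so adding \<open>d\<close> leads strictly between 0 and
    \<open>N div 2\<close> or strictly between \<open>N div 2\<close> and \<open>N\<close>, never to
    a joint.\<close>
  moreover have "Suc t mod N + d < N" using assms(1) d by auto
  ultimately have "Suc t' mod N = Suc t mod N + d" by simp
  then show False using assms d by auto
qed

lemma run_bound_lifted:
  assumes "run_bound ns H r" shows "run_bound (ns @ [m]) lifted r"
  unfolding run_bound_def
proof (intro allI impI)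
  fix s i assume "i < length (ns @ [m])"
  let ?J = "{j \<in> {s..<s + r}. step_in_dim (ns @ [m]) lifted i j}"
  show "card ?J \<le> 1"
  proof (cases "i < length ns")
    case True
    \<comment> \<open>Vertical steps only remove steps from the old dimensions, at unchanged
      times.\<close>
    then have "?J \<subseteq> {j \<in> {s..<s + r}. step_in_dim ns H i j}"
      using step_in_dim_lifted[of i] by auto
    then have "card ?J \<le> card {j \<in> {s..<s + r}. step_in_dim ns H i j}"
      by (intro card_mono) auto
    also have "\<dots> \<le> 1" using assms True by (simp add: run_bound_def)
    finally show ?thesis .
  next
    case False
    \<comment> \<open>A window no longer than half a turn contains at most one vertical
      step.\<close>
    have r: "r \<le> N div 2"
      using run_bound_le[OF torus ham assms] length_ns_le by linarith
    have J: "Suc j mod N \<in> {0, N div 2}" if "j \<in> ?J" for j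
      using that step_in_dim_lifted[of i j] False by simp
    have "\<not> j < j'" if "j \<in> ?J" "j' \<in> ?J" for j j'
      using joints_apart[OF J[OF that(1)] J[OF that(2)]] that r by auto
    then show ?thesis
      by (intro card_le_Suc0_iff_eq[THEN iffD2, unfolded One_nat_def[symmetric]])
        (auto dest: linorder_neqE_nat)
  qed
qed

end

theorem theorem4:
  fixes ns :: "nat list" and m :: nat
  assumes "is_torus ns"
    and "\<exists>H. hamiltonian_cycle ns H"
    and "even (card (verts ns))"
    and "2 \<le> m"
  shows "(\<exists>H. hamiltonian_cycle (ns @ [m]) H) \<and>
         max_run_length (ns @ [m]) \<ge> max_run_length ns"
proof -
  let ?R = "\<lambda>ns. {run_length ns H | H. hamiltonian_cycle ns H}"
  have torus': "is_torus (ns @ [m])" using assms(1,4) by (auto simp: is_torus_def)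
  have "max_run_length ns \<in> ?R ns"
    unfolding max_run_length_def using assms(2) by (intro Max_in finite_run_lengths) auto
  then obtain H where H: "hamiltonian_cycle ns H" "max_run_length ns = run_length ns H" by auto
  interpret ham_torus ns H m using assms(1,4) H(1) by unfold_locales
  have "run_bound (ns @ [m]) lifted (run_length ns H)"
    by (intro run_bound_lifted run_bound_run_length assms(1) H(1))
  then have "run_length ns H \<le> run_length (ns @ [m]) lifted"
    by (intro le_run_length torus' hamiltonian_lifted)
  also have "\<dots> \<le> max_run_length (ns @ [m])"
    unfolding max_run_length_def using hamiltonian_lifted
    by (intro Max_ge finite_run_lengths) auto
  finally show ?thesis using H(2) hamiltonian_lifted by auto
qed

end
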